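(* Let $k\ge 1$, let $N$ be a positive even integer, and let $G^{\rm LP}$ be the LP relaxation permutation symmetry group of the orthogonal array defining integer linear program for $\mathrm{OA}(N,k,2,1)$ (the case $t=1$ of the program in the context). Then $$G^{\rm LP}\cong S_2\wr S_k .$$
   Context: An $\mathrm{OA}(N,k,2,t)$ (with $1\le t\le k$ and $N$ a positive multiple of $2^t$) is an $N\times k$ array with entries from $\{1,-1\}$ such that in every choice of $t$ columns each $t$-tuple appears exactly $N/2^t$ times. Full factorial design: list the $2^k$ elements of $\{1,-1\}^k$ as the rows of a $2^k\times k$ matrix; for $i=1,\dots,k$ let $\mathbf{x}_i\in\{1,-1\}^{2^k}$ be its $i$-th column. Let $\mathbf{1}$ be the all-ones vector of length $2^k$. For distinct $i_1,\dots,i_j$ ($j\ge 2$), $\mathbf{x}_{i_1,\dots,i_j}=\mathbf{x}_{i_1}\odot\cdots\odot\mathbf{x}_{i_j}$ is the entrywise (Hadamard) product. For given $t$, let $\mathbf{M}$ be the $\sum_{i=0}^t\binom{k}{i}$ by $2^k$ matrix whose rows are $\mathbf{1}^\top$ and all $\mathbf{x}_{i_1,\dots,i_j}^\top$ with $1\le i_1<\cdots<i_j\le k$, $1\le j\le t$ (first row $\mathbf{1}^\top$), and let $\mathbf{J}=(N,0,\dots,0)^\top$. The $\mathrm{OA}(N,k,2,t)$ defining ILP is $$\min 0:\ \mathbf{M}\mathbf{f}=\mathbf{J},\ \mathbf{f}\ge\mathbf{0},\ \mathbf{f}\in\mathbb{Z}^{2^k}.$$ Its LP relaxation has feasible set $\{\mathbf{f}\in\mathbb{Q}_{\ge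 0}^{2^k}:\mathbf{M}\mathbf{f}=\mathbf{J}\}$. The symmetric group $S_{2^k}$ acts on vectors of length $2^k$ by permuting coordinates, and the LP relaxation permutation symmetry group $G^{\rm LP}$ is the group of all $\pi\in S_{2^k}$ that send every LP relaxation feasible point to an LP relaxation feasible point (the objective function is constant). $S_2\wr S_k=S_2^k\rtimes S_k$ is the wreath product, with $S_k$ permuting the $k$ copies of $S_2$ (so it has order $2^k k!$). *)

theory Defs
  imports "HOL-Algebra.Algebra"
begin

text \<open>
  \<open>D r i\<close> is the entry in row \<open>r\<close> and column \<open>i\<close> of the full factorial design; the rows
  list the elements of \<open>{1,-1}\<^sup>k\<close> in any order, each exactly once.
\<close>
definition full_factorial :: "nat \<Rightarrow> (nat \<Rightarrow> nat \<Rightarrow> int) \<Rightarrow> bool" where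
  "full_factorial k D \<longleftrightarrow> bij_betw D {1..2 ^ k} ({1..k} \<rightarrow>\<^sub>E {1, -1})"

text \<open>
  The rows of \<open>M\<close> are indexed by the sets \<open>S = {i\<^sub>1 < \<dots> < i\<^sub>j}\<close> of at most \<open>t\<close> factors: row
  \<open>S\<close> is the Hadamard product of the columns \<open>x\<^sub>i\<close> with \<open>i \<in> S\<close>. The empty set gives the
  all-ones row, whose entry in the right-hand side \<open>J\<close> is \<open>N\<close>.
\<close>
definition oa_rows :: "nat \<Rightarrow> nat \<Rightarrow> nat set set" where
  "oa_rows k t = {S. S \<subseteq> {1..k} \<and> card S \<le> t}"

definition oa_mat :: "(nat \<Rightarrow> nat \<Rightarrow> int) \<Rightarrow> nat set \<Rightarrow> nat \<Rightarrow> int" where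
  "oa_mat D S r = (\<Prod>i\<in>S. D r i)"

definition oa_rhs :: "nat \<Rightarrow> nat set \<Rightarrow> int" where
  "oa_rhs N S = (if S = {} then int N else 0)"

text \<open>
  Nonnegative solutions of \<open>M f = J\<close>; a vector of length \<open>2 ^ k\<close> is an extensional function on
  \<open>{1..2 ^ k}\<close>. Over the type \<open>int\<close> this is the feasible set of the integer
  linear program, over \<open>rat\<close> that of its LP relaxation.
\<close>
definition oa_feasible ::
    "nat \<Rightarrow> nat \<Rightarrow> nat \<Rightarrow> (nat \<Rightarrow> nat \<Rightarrow> int) \<Rightarrow> (nat \<Rightarrow> 'a::linordered_idom) set" where
  "oa_feasible N k t D =
     {f \<in> {1..2 ^ k} \<rightarrow>\<^sub>E {0..}.
        \<forall>S \<in> oa_rows k t. (\<Sum>r = 1..2 ^ k. of_int (oa_mat D S r) * f r) = of_int (oa_rhs N S)}"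

abbreviation oa_lp_feasible ::
    "nat \<Rightarrow> nat \<Rightarrow> nat \<Rightarrow> (nat \<Rightarrow> nat \<Rightarrow> int) \<Rightarrow> (nat \<Rightarrow> rat) set" where
  "oa_lp_feasible \<equiv> oa_feasible"

text \<open>
  A permutation of \<open>{1..n}\<close> moves the coordinate in position \<open>r\<close> to position \<open>\<pi> r\<close>. (It fixes
  everything outside \<open>{1..n}\<close>, so extensionality is preserved.)
\<close>
definition permute_coords :: "(nat \<Rightarrow> nat) \<Rightarrow> (nat \<Rightarrow> 'a) \<Rightarrow> nat \<Rightarrow> 'a" where
  "permute_coords \<pi> f = f \<circ> inv' \<pi>"

definition oa_lp_symmetry_group ::
    "nat \<Rightarrow> nat \<Rightarrow> nat \<Rightarrow> (nat \<Rightarrow> nat \<Rightarrow> int) \<Rightarrow> (nat \<Rightarrow> nat) monoid" where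
  "oa_lp_symmetry_group N k t D =
     (sym_group (2 ^ k)) \<lparr> carrier :=
       {\<pi> \<in> carrier (sym_group (2 ^ k)).
          \<forall>f \<in> oa_lp_feasible N k t D. permute_coords \<pi> f \<in> oa_lp_feasible N k t D} \<rparr>"

definition semidirect_product ::
    "('h \<Rightarrow> 'g \<Rightarrow> 'g) \<Rightarrow> ('g, 'a) monoid_scheme \<Rightarrow> ('h, 'b) monoid_scheme \<Rightarrow> ('g \<times> 'h) monoid" where
  "semidirect_product \<phi> G H =
     \<lparr> carrier = carrier G \<times> carrier H,
       monoid.mult = (\<lambda>(g, h) (g', h'). (g \<otimes>\<^bsub>G\<^esub> \<phi> h g', h \<otimes>\<^bsub>H\<^esub> h')),
       one = (\<one>\<^bsub>G\<^esub>, \<one>\<^bsub>H\<^esub>) \<rparr>"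

definition wreath_sym :: "('g, 'a) monoid_scheme \<Rightarrow> nat \<Rightarrow> ((nat \<Rightarrow> 'g) \<times> (nat \<Rightarrow> nat)) monoid" where
  "wreath_sym G k =
     semidirect_product permute_coords (product_group {1..k} (\<lambda>_. G)) (sym_group k)"

end

theory Submission
  imports Defs
begin

text \<open>
  The wreath product acts on \<open>{1,-1}\<^sup>k\<close> by signed coordinate permutations, and relabelling the
  rows of the design accordingly preserves the feasible set. Conversely, let \<open>\<pi>\<close> preserve the
  feasible set and read the \<open>i\<close>-th column of the design after applying \<open>\<pi>\<close> as a \<open>{1,-1}\<close>-valued
  function \<open>y\<close> on the cube. Any multiset of rows summing to zero is, after scaling, a feasible
  point, so \<open>y\<close> sums to zero over it. The multisets \<open>{x, -x}\<close> show that \<open>y\<close> is odd; the multisets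
  consisting of \<open>v\<close>, \<open>-1\<close>, the negated flips of \<open>1\<close> in the negative coordinates of \<open>v\<close>, and as
  many copies of \<open>1\<close>, show that \<open>y\<close> is affine. An odd affine function with values in \<open>{1,-1}\<close> is
  a coordinate up to sign.
\<close>

section \<open>Preliminaries on multiplicities, permutations of two points and the feasible
  set\<close>

lemma sum_list_map_count:
  fixes f :: "'a \<Rightarrow> 'b::comm_semiring_1"
  assumes "finite A" "set xs \<subseteq> A"
  shows "(\<Sum>x\<leftarrow>xs. f x) = (\<Sum>x\<in>A. f x * of_nat (count_list xs x))"
  using assms(2)
proof (induction xs)
  case (Cons a xs)
  have "(\<Sum>x\<in>A. f x * of_nat (count_list (a # xs) x))
      = (\<Sum>x\<in>A. (if x = a then f a else 0) + f x * of_nat (count_list xs x))"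
    by (intro sum.cong) (auto simp: algebra_simps)
  also have "\<dots> = f a + (\<Sum>x\<in>A. f x * of_nat (count_list xs x))"
    using Cons.prems assms(1) by (simp add: sum.distrib)
  finally show ?case using Cons by simp
qed simp

text \<open>The identity is even and the swap is odd. Hence signs can stand in for the elements of
  \<open>S_2\<close> without loss, which gives faithfulness of the action by sign changes.\<close>

lemma sign_eq_iff_permutes_2:
  assumes "p permutes {1..2::nat}" "q permutes {1..2::nat}" "sign p = sign q"
  shows "p = q"
proof -
  have "{1..2::nat} = {1,2}" by auto
  then show ?thesis
    using assms by (auto simp: permutes_doubleton_iff sign_swap_id)
qed

text \<open>Injectivity of \<open>\<phi>\<close> transfers the homomorphism law to its inverse;
  closure puts the product of two preimages in the carrier, where the inverse undoes
  \<open>\<phi>\<close>. This reverses the isomorphism constructed below from the wreath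
  product.\<close>

lemma iso_inv_into:
  assumes "\<phi> \<in> iso G H"
    and closed: "\<And>x y. x \<in> carrier G \<Longrightarrow> y \<in> carrier G \<Longrightarrow> x \<otimes>\<^bsub>G\<^esub> y \<in> carrier G"
  shows "inv_into (carrier G) \<phi> \<in> iso H G"
proof -
  have hom: "\<phi> \<in> hom G H" and bij: "bij_betw \<phi> (carrier G) (carrier H)"
    using assms(1) by (auto simp: iso_def)
  let ?i = "inv_into (carrier G) \<phi>"
  have bij': "bij_betw ?i (carrier H) (carrier G)" by (rule bij_betw_inv_into[OF bij])
  have "?i (x \<otimes>\<^bsub>H\<^esub> y) = ?i x \<otimes>\<^bsub>G\<^esub> ?i y" if "x \<in> carrier H" "y \<in> carrier H" for x y
  proof -
    have i: "?i x \<in> carrier G" "?i y \<in> carrier G"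
      using bij' that by (auto dest: bij_betwE)
    have "x \<otimes>\<^bsub>H\<^esub> y = \<phi> (?i x \<otimes>\<^bsub>G\<^esub> ?i y)"
      using hom_mult[OF hom i] that bij by (simp add: bij_betw_inv_into_right)
    then show ?thesis
      using bij_betw_inv_into_left[OF bij closed[OF i]] by simp
  qed
  then show ?thesis
    using bij' by (auto simp: iso_def hom_def dest: bij_betwE)
qed

text \<open>A set of at most one factor is empty or a singleton: the empty set prescribes the total
  weight, and the singletons make \<open>f\<close> orthogonal to the columns of the design.\<close>

lemma oa_lp_feasible_1_iff:
  "f \<in> oa_lp_feasible N k 1 D \<longleftrightarrow>
     f \<in> {1..2 ^ k} \<rightarrow>\<^sub>E {0..} \<and> (\<Sum>r = 1..2 ^ k. f r) = of_nat N \<and>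
     (\<forall>i\<in>{1..k}. (\<Sum>r = 1..2 ^ k. of_int (D r i) * f r) = 0)"
proof -
  have "S = {} \<or> (\<exists>i\<in>{1..k}. S = {i})" if "S \<subseteq> {1..k}" "card S \<le> 1" for S :: "nat set"
  proof (cases "card S = 0")
    case True
    then show ?thesis using that finite_subset[of S "{1..k}"] by auto
  next
    case False
    then have "card S = 1" using that by simp
    then show ?thesis using that by (auto simp: card_1_singleton_iff)
  qed
  then have "oa_rows k 1 = insert {} ((\<lambda>i. {i}) ` {1..k})"
    by (auto simp: oa_rows_def)
  then show ?thesis by (simp add: oa_feasible_def oa_mat_def oa_rhs_def)
qed

section \<open>Sign vectors and the signed action of the wreath product\<close>

abbreviation sign_cube :: "nat \<Rightarrow> (nat \<Rightarrow> int) set" where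
  "sign_cube k \<equiv> {1..k} \<rightarrow>\<^sub>E {1, -1}"

text \<open>Only \<open>S \<inter> {1..k}\<close> matters, so complements can be taken in all of
  \<open>nat\<close>: \<open>- S\<close> gives the negated vector and \<open>UNIV\<close> the vector
  with all entries -1.\<close>

definition sign_vec :: "nat \<Rightarrow> nat set \<Rightarrow> nat \<Rightarrow> int" where
  "sign_vec k S = (\<lambda>i\<in>{1..k}. if i \<in> S then -1 else 1)"

lemma sign_vec_in_cube [simp]: "sign_vec k S \<in> sign_cube k"
  by (auto simp: sign_vec_def)

lemma sign_vec_apply: "i \<in> {1..k} \<Longrightarrow> sign_vec k S i = (if i \<in> S then -1 else 1)"
  by (simp add: sign_vec_def)

lemma sign_vec_surj:
  assumes "x \<in> sign_cube k"
  shows "x = sign_vec k {i \<in> {1..k}. x i = -1}"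
proof (rule PiE_ext[OF assms sign_vec_in_cube])
  show "x i = sign_vec k {i \<in> {1..k}. x i = -1} i" if "i \<in> {1..k}" for i
    using PiE_mem[OF assms that] that by (auto simp: sign_vec_def)
qed

text \<open>The entry in position \<open>j\<close> moves to position \<open>snd w j\<close>, as in
  \<open>permute_coords\<close>, and then the signs are applied. With this convention the wreath
  multiplication becomes composition of actions.\<close>

definition signed_action ::
    "nat \<Rightarrow> (nat \<Rightarrow> nat \<Rightarrow> nat) \<times> (nat \<Rightarrow> nat) \<Rightarrow> (nat \<Rightarrow> int) \<Rightarrow> nat \<Rightarrow> int" where
  "signed_action k w x = (\<lambda>i\<in>{1..k}. sign (fst w i) * x (inv' (snd w) i))"

lemma carrier_wreath_sym:
  "w \<in> carrier (wreath_sym (sym_group n) k) \<longleftrightarrow>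
     fst w \<in> {1..k} \<rightarrow>\<^sub>E {p. p permutes {1..n}} \<and> snd w permutes {1..k}"
  by (cases w) (simp add: wreath_sym_def semidirect_product_def sym_group_def)

lemma mult_wreath_sym:
  "v \<otimes>\<^bsub>wreath_sym (sym_group n) k\<^esub> w =
     ((\<lambda>i\<in>{1..k}. fst v i \<circ> fst w (inv' (snd v) i)), snd v \<circ> snd w)"
  by (cases v, cases w)
    (simp add: wreath_sym_def semidirect_product_def sym_group_mult permute_coords_def)

lemma wreath_sym_closed:
  assumes "v \<in> carrier (wreath_sym (sym_group n) k)" "w \<in> carrier (wreath_sym (sym_group n) k)"
  shows "v \<otimes>\<^bsub>wreath_sym (sym_group n) k\<^esub> w \<in> carrier (wreath_sym (sym_group n) k)"
proof -
  have v: "fst v \<in> {1..k} \<rightarrow>\<^sub>E {p. p permutes {1..n}}" "snd v permutes {1..k}"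
    and w: "fst w \<in> {1..k} \<rightarrow>\<^sub>E {p. p permutes {1..n}}" "snd w permutes {1..k}"
    using assms by (auto simp: carrier_wreath_sym)
  have "fst v i \<circ> fst w (inv' (snd v) i) permutes {1..n}" if i: "i \<in> {1..k}" for i
  proof -
    have "inv' (snd v) i \<in> {1..k}"
      using permutes_in_image[OF permutes_inv[OF v(2)]] i by blast
    then show ?thesis
      using permutes_compose[of "fst w (inv' (snd v) i)" "{1..n}" "fst v i"]
        PiE_mem[OF v(1) i] PiE_mem[OF w(1)] by blast
  qed
  then show ?thesis
    using permutes_compose[OF w(2) v(2)] by (simp add: mult_wreath_sym carrier_wreath_sym)
qed

lemma signed_action_in_cube:
  assumes "w \<in> carrier (wreath_sym (sym_group n) k)" "x \<in> sign_cube k"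
  shows "signed_action k w x \<in> sign_cube k"
proof -
  have "sign (fst w i) * x (inv' (snd w) i) \<in> {1, -1}" if "i \<in> {1..k}" for i
  proof -
    have h: "snd w permutes {1..k}" using assms(1) by (simp add: carrier_wreath_sym)
    have "inv' (snd w) i \<in> {1..k}" using permutes_in_image[OF permutes_inv[OF h]] that by blast
    then have "x (inv' (snd w) i) \<in> {1, -1}" using assms(2) by (rule PiE_mem[rotated])
    then show ?thesis by (cases "fst w i" rule: sign_cases) auto
  qed
  then show ?thesis unfolding signed_action_def by (simp only: restrict_PiE_iff) blast
qed

lemma signed_action_mult:
  assumes "v \<in> carrier (wreath_sym (sym_group n) k)" "w \<in> carrier (wreath_sym (sym_group n) k)"
  shows "signed_action k (v \<otimes>\<^bsub>wreath_sym (sym_group n) k\<^esub> w) x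
       = signed_action k v (signed_action k w x)"
proof
  fix i
  have v: "fst v \<in> {1..k} \<rightarrow>\<^sub>E {p. p permutes {1..n}}" "snd v permutes {1..k}"
    and w: "fst w \<in> {1..k} \<rightarrow>\<^sub>E {p. p permutes {1..n}}" "snd w permutes {1..k}"
    using assms by (auto simp: carrier_wreath_sym)
  show "signed_action k (v \<otimes>\<^bsub>wreath_sym (sym_group n) k\<^esub> w) x i
       = signed_action k v (signed_action k w x) i"
  proof (cases "i \<in> {1..k}")
    case True
    define j where "j = inv' (snd v) i"
    have j: "j \<in> {1..k}"
      using permutes_in_image[OF permutes_inv[OF v(2)]] True by (simp add: j_def)
    have "fst v i permutes {1..n}" "fst w j permutes {1..n}"
      using PiE_mem[OF v(1) True] PiE_mem[OF w(1) j] by auto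
    then have "sign (fst v i \<circ> fst w j) = sign (fst v i) * sign (fst w j)"
      by (intro sign_compose permutes_imp_permutation) auto
    moreover have "inv' (snd v \<circ> snd w) i = inv' (snd w) j"
      using o_inv_distrib[OF permutes_bij[OF v(2)] permutes_bij[OF w(2)]] by (simp add: j_def)
    ultimately show ?thesis
      using True j by (simp add: signed_action_def mult_wreath_sym j_def mult.assoc)
  next
    case False
    then show ?thesis by (simp only: signed_action_def restrict_apply if_False)
  qed
qed

lemma signed_action_inj_point:
  assumes "w \<in> carrier (wreath_sym (sym_group n) k)" "x \<in> sign_cube k" "y \<in> sign_cube k"
    and eq: "signed_action k w x = signed_action k w y"
  shows "x = y"
proof (rule PiE_ext[OF assms(2,3)])
  fix i assume i: "i \<in> {1..k}"
  have h: "snd w permutes {1..k}" using assms(1) by (simp add: carrier_wreath_sym)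
  \<comment> \<open>At position \<open>snd w i\<close> both images carry the \<open>i\<close>-th
    entry times the same nonzero sign.\<close>
  have "snd w i \<in> {1..k}" using permutes_in_image[OF h] i by blast
  then show "x i = y i"
    using fun_cong[OF eq, of "snd w i"] permutes_inverses[OF h] by (simp add: signed_action_def)
qed

text \<open>The all-ones vector reveals the signs. Once these agree, a vector with a single entry -1
  reveals where each position is read from, hence the permutation.\<close>

lemma signed_action_faithful:
  assumes v: "v \<in> carrier (wreath_sym (sym_group 2) k)"
    and w: "w \<in> carrier (wreath_sym (sym_group 2) k)"
    and eq: "\<And>x. x \<in> sign_cube k \<Longrightarrow> signed_action k v x = signed_action k w x"
  shows "v = w"
proof -
  have v1: "fst v \<in> {1..k} \<rightarrow>\<^sub>E {p. p permutes {1..2}}" and v2: "snd v permutes {1..k}"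
    and w1: "fst w \<in> {1..k} \<rightarrow>\<^sub>E {p. p permutes {1..2}}" and w2: "snd w permutes {1..k}"
    using v w by (auto simp: carrier_wreath_sym)
  note v2' = permutes_inv[OF v2] and w2' = permutes_inv[OF w2]
  have eq': "sign (fst v i) * sign_vec k S (inv' (snd v) i)
           = sign (fst w i) * sign_vec k S (inv' (snd w) i)" if "i \<in> {1..k}" for i S
    using fun_cong[OF eq[OF sign_vec_in_cube[of k S]], of i] that by (simp add: signed_action_def)
  have im: "inv' (snd v) i \<in> {1..k}" "inv' (snd w) i \<in> {1..k}" if "i \<in> {1..k}" for i
    using permutes_in_image[OF v2'] permutes_in_image[OF w2'] that by blast+
  have sgn: "sign (fst v i) = sign (fst w i)" if "i \<in> {1..k}" for i
    using eq'[OF that, of "{}"] im[OF that] by (simp add: sign_vec_apply del: atLeastAtMost_iff)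
  have "fst v = fst w"
  proof (rule PiE_ext[OF v1 w1])
    show "fst v i = fst w i" if "i \<in> {1..k}" for i
      using sign_eq_iff_permutes_2[OF _ _ sgn[OF that]] PiE_mem[OF v1 that] PiE_mem[OF w1 that]
      by auto
  qed
  moreover have "inv' (snd v) i = inv' (snd w) i" for i
  proof (cases "i \<in> {1..k}")
    case True
    show ?thesis
      using eq'[OF True, of "{inv' (snd v) i}"] im[OF True] sgn[OF True]
      by (simp add: sign_vec_apply del: atLeastAtMost_iff split: if_splits)
  next
    case False
    then show ?thesis using permutes_not_in[OF v2'] permutes_not_in[OF w2'] by simp
  qed
  then have "inv' (snd v) = inv' (snd w)" by blast
  then have "snd v = snd w"
    using inv_inv_eq[OF permutes_bij[OF v2]] inv_inv_eq[OF permutes_bij[OF w2]] by metis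
  ultimately show ?thesis by (simp add: prod_eq_iff)
qed

section \<open>Signed permutations as relabellings of the rows of the design\<close>

locale factorial_design =
  fixes k :: nat and D :: "nat \<Rightarrow> nat \<Rightarrow> int"
  assumes full: "full_factorial k D"
begin

definition row :: "(nat \<Rightarrow> int) \<Rightarrow> nat" where
  "row = inv_into {1..2 ^ k} D"

lemma bij_D: "bij_betw D {1..2 ^ k} (sign_cube k)"
  using full by (simp add: full_factorial_def)

lemma D_in_cube: "r \<in> {1..2 ^ k} \<Longrightarrow> D r \<in> sign_cube k"
  using bij_D by (rule bij_betw_apply)

lemma row_in: "x \<in> sign_cube k \<Longrightarrow> row x \<in> {1..2 ^ k}"
  using bij_betw_inv_into[OF bij_D] unfolding row_def by (rule bij_betw_apply)

lemma D_row: "x \<in> sign_cube k \<Longrightarrow> D (row x) = x"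
  unfolding row_def by (rule bij_betw_inv_into_right[OF bij_D])

lemma row_D: "r \<in> {1..2 ^ k} \<Longrightarrow> row (D r) = r"
  unfolding row_def by (rule bij_betw_inv_into_left[OF bij_D])

lemma D_row_sign_vec [simp]: "D (row (sign_vec k S)) = sign_vec k S"
  by (rule D_row[OF sign_vec_in_cube])

definition row_perm :: "(nat \<Rightarrow> nat \<Rightarrow> nat) \<times> (nat \<Rightarrow> nat) \<Rightarrow> nat \<Rightarrow> nat" where
  "row_perm w r = (if r \<in> {1..2 ^ k} then row (signed_action k w (D r)) else r)"

lemma D_row_perm:
  assumes "w \<in> carrier (wreath_sym (sym_group n) k)" "r \<in> {1..2 ^ k}"
  shows "D (row_perm w r) = signed_action k w (D r)"
  using D_row[OF signed_action_in_cube[OF assms(1) D_in_cube[OF assms(2)]]] assms(2)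
  by (simp add: row_perm_def)

lemma row_perm_in:
  assumes "w \<in> carrier (wreath_sym (sym_group n) k)" "r \<in> {1..2 ^ k}"
  shows "row_perm w r \<in> {1..2 ^ k}"
  using row_in[OF signed_action_in_cube[OF assms(1) D_in_cube[OF assms(2)]]] assms(2)
  by (simp add: row_perm_def)

lemma row_perm_permutes:
  assumes "w \<in> carrier (wreath_sym (sym_group n) k)"
  shows "row_perm w permutes {1..2 ^ k}"
proof (rule bij_imp_permutes)
  have "inj_on (row_perm w) {1..2 ^ k}"
  proof (rule inj_onI)
    fix r s assume rs: "r \<in> {1..2 ^ k}" "s \<in> {1..2 ^ k}" "row_perm w r = row_perm w s"
    then have "signed_action k w (D r) = signed_action k w (D s)"
      using D_row_perm[OF assms] by metis
    then have "D r = D s"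
      using signed_action_inj_point[OF assms] D_in_cube rs by blast
    then show "r = s" using row_D rs by metis
  qed
  moreover have "row_perm w ` {1..2 ^ k} \<subseteq> {1..2 ^ k}"
    using row_perm_in[OF assms] by blast
  ultimately show "bij_betw (row_perm w) {1..2 ^ k} {1..2 ^ k}"
    unfolding bij_betw_def using endo_inj_surj[of "{1..2 ^ k}" "row_perm w"] by blast
qed (simp only: row_perm_def if_False)

lemma row_perm_mult:
  assumes v: "v \<in> carrier (wreath_sym (sym_group n) k)"
    and w: "w \<in> carrier (wreath_sym (sym_group n) k)"
  shows "row_perm (v \<otimes>\<^bsub>wreath_sym (sym_group n) k\<^esub> w) = row_perm v \<circ> row_perm w"
proof
  fix r
  show "row_perm (v \<otimes>\<^bsub>wreath_sym (sym_group n) k\<^esub> w) r = (row_perm v \<circ> row_perm w) r"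
  proof (cases "r \<in> {1..2 ^ k}")
    case True
    have "(row_perm v \<circ> row_perm w) r = row (signed_action k v (D (row_perm w r)))"
      using row_perm_in[OF w True] by (simp add: row_perm_def[of v])
    also have "\<dots> = row_perm (v \<otimes>\<^bsub>wreath_sym (sym_group n) k\<^esub> w) r"
      using True unfolding D_row_perm[OF w True]
      by (simp add: signed_action_mult[OF v w] row_perm_def)
    finally show ?thesis by simp
  next
    case False
    then show ?thesis by (simp only: row_perm_def o_apply if_False)
  qed
qed

lemma row_perm_inj: "inj_on row_perm (carrier (wreath_sym (sym_group 2) k))"
proof (rule inj_onI)
  fix v w
  assume v: "v \<in> carrier (wreath_sym (sym_group 2) k)"
    and w: "w \<in> carrier (wreath_sym (sym_group 2) k)" and eq: "row_perm v = row_perm w"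
  have "signed_action k v x = signed_action k w x" if "x \<in> sign_cube k" for x
    using D_row_perm[OF v row_in[OF that]] D_row_perm[OF w row_in[OF that]] eq D_row[OF that]
    by simp
  then show "v = w" by (rule signed_action_faithful[OF v w])
qed

lemma permute_coords_feasible_iff:
  assumes \<pi>: "\<pi> permutes {1..2 ^ k}" and f: "f \<in> oa_lp_feasible N k 1 D"
  shows "permute_coords \<pi> f \<in> oa_lp_feasible N k 1 D \<longleftrightarrow>
    (\<forall>i\<in>{1..k}. (\<Sum>r = 1..2 ^ k. of_int (D (\<pi> r) i) * f r) = 0)"
proof -
  note \<pi>' = permutes_inv[OF \<pi>]
  \<comment> \<open>Reindexing by \<open>\<pi>\<close> moves the permutation from the weights to the
    design. With \<open>F\<close> constantly 1 this shows that the total weight is kept, so only the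
    column equations remain to be checked.\<close>
  have *: "(\<Sum>r = 1..2 ^ k. F r * permute_coords \<pi> f r) = (\<Sum>r = 1..2 ^ k. F (\<pi> r) * f r)"
    for F :: "nat \<Rightarrow> rat"
    unfolding sum.permute[OF \<pi>, of "\<lambda>r. F r * permute_coords \<pi> f r"]
    by (simp add: permute_coords_def permutes_inverses[OF \<pi>])
  have ext: "permute_coords \<pi> f \<in> {1..2 ^ k} \<rightarrow>\<^sub>E {0..}"
  proof
    have f': "f \<in> {1..2 ^ k} \<rightarrow>\<^sub>E {0..}" using f unfolding oa_lp_feasible_1_iff by simp
    show "permute_coords \<pi> f r \<in> {0..}" if "r \<in> {1..2 ^ k}" for r
      using permutes_in_image[OF \<pi>', of r] that PiE_mem[OF f']
      by (simp add: permute_coords_def del: atLeastAtMost_iff)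
    show "permute_coords \<pi> f r = undefined" if "r \<notin> {1..2 ^ k}" for r
      using permutes_not_in[OF \<pi>' that] PiE_arb[OF f' that] by (simp add: permute_coords_def)
  qed
  show ?thesis
    using f *[of "\<lambda>_. 1"] ext unfolding oa_lp_feasible_1_iff
    by (simp add: * del: atLeastAtMost_iff One_nat_def)
qed

text \<open>Column \<open>i\<close> of the relabelled design is an original column times a sign, so
  its equation is a multiple of one that \<open>f\<close> already satisfies.\<close>

lemma row_perm_in_symmetry_group:
  assumes w: "w \<in> carrier (wreath_sym (sym_group n) k)"
  shows "row_perm w \<in> carrier (oa_lp_symmetry_group N k 1 D)"
proof -
  note p = row_perm_permutes[OF w]
  have h: "snd w permutes {1..k}" using w by (simp add: carrier_wreath_sym)
  have "permute_coords (row_perm w) f \<in> oa_lp_feasible N k 1 D"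
    if f: "f \<in> oa_lp_feasible N k 1 D" for f
    unfolding permute_coords_feasible_iff[OF p f]
  proof
    fix i assume i: "i \<in> {1..k}"
    let ?j = "inv' (snd w) i"
    have j: "?j \<in> {1..k}" using permutes_in_image[OF permutes_inv[OF h]] i by blast
    have "(\<Sum>r = 1..2 ^ k. of_int (D (row_perm w r) i) * f r)
        = (\<Sum>r = 1..2 ^ k. of_int (sign (fst w i)) * (of_int (D r ?j) * f r))"
      using i by (intro sum.cong refl) (simp add: D_row_perm[OF w] signed_action_def)
    also have "\<dots> = of_int (sign (fst w i)) * (\<Sum>r = 1..2 ^ k. of_int (D r ?j) * f r)"
      by (simp add: sum_distrib_left)
    also have "\<dots> = 0" using f j unfolding oa_lp_feasible_1_iff by simp
    finally show "(\<Sum>r = 1..2 ^ k. of_int (D (row_perm w r) i) * f r) = 0" .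
  qed
  then show ?thesis using p by (simp add: oa_lp_symmetry_group_def sym_group_carrier)
qed

section \<open>Recovering a signed permutation from a symmetry of the feasible set\<close>

lemma symmetry_balanced:
  assumes \<pi>: "\<pi> \<in> carrier (oa_lp_symmetry_group N k 1 D)" and "N > 0"
    and xs: "xs \<noteq> []" "set xs \<subseteq> {1..2 ^ k}"
    and bal: "\<And>i. i \<in> {1..k} \<Longrightarrow> (\<Sum>r\<leftarrow>xs. D r i) = 0"
    and i: "i \<in> {1..k}"
  shows "(\<Sum>r\<leftarrow>xs. D (\<pi> r) i) = 0"
proof -
  have p: "\<pi> permutes {1..2 ^ k}"
    using \<pi> by (simp add: oa_lp_symmetry_group_def sym_group_carrier)
  \<comment> \<open>The multiplicities in \<open>xs\<close> add up to \<open>length xs\<close>, so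
    this factor rescales the total weight to \<open>N\<close>. It may be fractional: here the
    passage to the LP relaxation is used.\<close>
  define c :: rat where "c = of_nat N / of_nat (length xs)"
  have c: "c > 0" using \<open>N > 0\<close> xs(1) by (simp add: c_def)
  define f :: "nat \<Rightarrow> rat" where "f = (\<lambda>r\<in>{1..2 ^ k}. c * of_nat (count_list xs r))"
  have sum_f: "(\<Sum>r = 1..2 ^ k. of_int (F r) * f r) = c * of_int (\<Sum>r\<leftarrow>xs. F r)"
    for F :: "nat \<Rightarrow> int"
  proof -
    have "c * of_int (\<Sum>r\<leftarrow>xs. F r)
        = c * of_int (\<Sum>r = 1..2 ^ k. F r * of_nat (count_list xs r))"
      by (subst sum_list_map_count[OF _ xs(2)]) simp_all
    also have "\<dots> = (\<Sum>r = 1..2 ^ k. of_int (F r) * f r)"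
      by (simp add: f_def sum_distrib_left mult_ac)
    finally show ?thesis by simp
  qed
  have "f \<in> {1..2 ^ k} \<rightarrow>\<^sub>E {0..}" using c by (auto simp: f_def)
  moreover have "(\<Sum>r = 1..2 ^ k. f r) = of_nat N"
    using sum_f[of "\<lambda>_. 1"] xs(1) by (simp add: c_def sum_list_triv)
  ultimately have f: "f \<in> oa_lp_feasible N k 1 D"
    unfolding oa_lp_feasible_1_iff
    using bal by (simp add: sum_f del: atLeastAtMost_iff One_nat_def)
  then have "permute_coords \<pi> f \<in> oa_lp_feasible N k 1 D"
    using \<pi> by (simp add: oa_lp_symmetry_group_def)
  then have "c * of_int (\<Sum>r\<leftarrow>xs. D (\<pi> r) i) = 0"
    using permute_coords_feasible_iff[OF p f] i unfolding sum_f by blast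
  then show ?thesis using c by simp
qed

text \<open>A symmetry can only permute the columns of the design and change their signs. This
  column-by-column form is what the reconstruction of a wreath product element starts from.\<close>

lemma symmetry_column:
  assumes \<pi>: "\<pi> \<in> carrier (oa_lp_symmetry_group N k 1 D)" and "N > 0" and i: "i \<in> {1..k}"
  shows "\<exists>a\<in>{1, -1}. \<exists>j\<in>{1..k}. \<forall>r\<in>{1..2 ^ k}. D (\<pi> r) i = a * D r j"
proof -
  note bal = symmetry_balanced[OF \<pi> \<open>N > 0\<close> _ _ _ i]
  \<comment> \<open>Points of the cube are encoded by the sets of their negative coordinates, so
    \<open>y\<close> becomes a function of sets.\<close>
  define y where "y S = D (\<pi> (row (sign_vec k S))) i" for S
  have p: "\<pi> permutes {1..2 ^ k}"
    using \<pi> by (simp add: oa_lp_symmetry_group_def sym_group_carrier)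
  have row: "row (sign_vec k S) \<in> {1..2 ^ k}" for S by (rule row_in[OF sign_vec_in_cube])
  have y: "y S = 1 \<or> y S = -1" for S
  proof -
    have "\<pi> (row (sign_vec k S)) \<in> {1..2 ^ k}" using permutes_in_image[OF p] row by blast
    then show ?thesis using PiE_mem[OF D_in_cube i] by (auto simp: y_def)
  qed
  have odd: "y (- S) = - y S" for S
  proof -
    let ?xs = "[row (sign_vec k S), row (sign_vec k (- S))]"
    have "(\<Sum>r\<leftarrow>?xs. D r l) = 0" if "l \<in> {1..k}" for l
      using that by (simp add: sign_vec_apply)
    then have "(\<Sum>r\<leftarrow>?xs. D (\<pi> r) i) = 0"
      using row by (intro bal) (simp_all del: atLeastAtMost_iff)
    then show ?thesis by (simp add: y_def)
  qed
  define a where "a = y {}"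
  have a: "a = 1 \<or> a = -1" using y by (simp add: a_def)
  have affine: "y S = a + (\<Sum>j\<in>S. y {j} - a)" if S: "S \<subseteq> {1..k}" for S
  proof -
    have fin: "finite S" using S finite_subset by blast
    \<comment> \<open>In coordinate \<open>l\<close> the last block sums to
      \<open>2 - card S\<close> if \<open>l \<in> S\<close> and to \<open>- card S\<close>
      otherwise. The \<open>card S\<close> copies of the all-ones row cancel
      \<open>- card S\<close>, and the first two rows contribute -2 or 0 respectively.\<close>
    define xs where "xs = row (sign_vec k S) # row (sign_vec k UNIV) #
      replicate (card S) (row (sign_vec k {})) @
      map (\<lambda>j. row (sign_vec k (- {j}))) (sorted_list_of_set S)"
    have sum_xs: "(\<Sum>r\<leftarrow>xs. F r) = F (row (sign_vec k S)) + F (row (sign_vec k UNIV)) +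
      int (card S) * F (row (sign_vec k {})) + (\<Sum>j\<in>S. F (row (sign_vec k (- {j}))))"
      for F :: "nat \<Rightarrow> int"
      using fin by (simp add: xs_def comp_def sum_list_replicate sum_list_distinct_conv_sum_set)
    have "(\<Sum>r\<leftarrow>xs. D r l) = 0" if l: "l \<in> {1..k}" for l
    proof -
      have "(\<Sum>j\<in>S. sign_vec k (- {j}) l) = (\<Sum>j\<in>S. (if j = l then 2 else 0) - 1)"
        using l by (intro sum.cong refl) (simp add: sign_vec_apply)
      also have "\<dots> = (if l \<in> S then 2 else 0) - int (card S)"
        using fin by (simp add: sum_subtractf)
      finally show ?thesis using l by (simp add: sum_xs sign_vec_apply)
    qed
    moreover have "set xs \<subseteq> {1..2 ^ k}" using row by (auto simp: xs_def simp del: atLeastAtMost_iff)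
    ultimately have "(\<Sum>r\<leftarrow>xs. D (\<pi> r) i) = 0" by (intro bal) (auto simp: xs_def)
    then have "y S + y UNIV + int (card S) * a + (\<Sum>j\<in>S. y (- {j})) = 0"
      by (simp add: sum_xs y_def a_def)
    moreover have "y UNIV = - a" using odd[of "{}"] by (simp add: a_def)
    ultimately show ?thesis by (simp add: odd sum_subtractf sum_negf)
  qed
  \<comment> \<open>These are the coordinates on which \<open>y\<close> depends: flipping one of
    them in the all-ones vector changes the value from \<open>a\<close> to
    \<open>- a\<close>.\<close>
  define T where "T = {j \<in> {1..k}. y {j} = - a}"
  have yT: "y S = a * (1 - 2 * int (card (S \<inter> T)))" if S: "S \<subseteq> {1..k}" for S
  proof -
    have fin: "finite S" using S finite_subset by blast
    have "y {j} - a = (if j \<in> T then - 2 * a else 0)" if "j \<in> S" for j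
      using that S a y[of "{j}"] by (auto simp: T_def)
    then have "(\<Sum>j\<in>S. y {j} - a) = (\<Sum>j\<in>S. if j \<in> T then - 2 * a else 0)"
      by (intro sum.cong refl)
    also have "\<dots> = - 2 * a * int (card (S \<inter> T))"
      using fin by (simp add: sum.inter_restrict[symmetric])
    finally show ?thesis using affine[OF S] by (simp add: algebra_simps)
  qed
  \<comment> \<open>Oddness at the all-ones vector gives the value \<open>- a\<close> on
    \<open>{1..k}\<close>; comparison with \<open>yT\<close> yields
    \<open>1 - 2 * card T = -1\<close>, so \<open>T\<close> is a singleton.\<close>
  have "sign_vec k {1..k} = sign_vec k (- {})" by (auto simp: sign_vec_def)
  then have "y {1..k} = - a" using odd[of "{}"] by (simp add: y_def a_def)
  then have "card ({1..k} \<inter> T) = 1" using yT[of "{1..k}"] a by auto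
  moreover have "{1..k} \<inter> T = T" by (auto simp: T_def)
  ultimately obtain j where T: "T = {j}" by (auto simp: card_1_singleton_iff)
  then have j: "j \<in> {1..k}" by (auto simp: T_def)
  have "D (\<pi> r) i = a * D r j" if r: "r \<in> {1..2 ^ k}" for r
  proof -
    define S where "S = {l \<in> {1..k}. D r l = -1}"
    have D: "D r = sign_vec k S" using sign_vec_surj[OF D_in_cube[OF r]] by (simp add: S_def)
    have "row (sign_vec k S) = r" using row_D[OF r] D by simp
    then have "D (\<pi> r) i = y S" by (simp add: y_def)
    also have "\<dots> = a * sign_vec k S j"
    proof -
      have "S \<subseteq> {1..k}" by (auto simp: S_def)
      then show ?thesis
        using yT[of S] j by (simp add: T sign_vec_apply del: atLeastAtMost_iff)
    qed
    finally show ?thesis using D by simp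
  qed
  then show ?thesis using a j by blast
qed

text \<open>The signs and source columns found for the individual \<open>i\<close> fit together to
  one wreath product element. The point to prove is that no source column is used twice.\<close>

lemma symmetry_in_range:
  assumes \<pi>: "\<pi> \<in> carrier (oa_lp_symmetry_group N k 1 D)" and "N > 0"
  shows "\<pi> \<in> row_perm ` carrier (wreath_sym (sym_group 2) k)"
proof -
  have p: "\<pi> permutes {1..2 ^ k}"
    using \<pi> by (simp add: oa_lp_symmetry_group_def sym_group_carrier)
  have "\<forall>i\<in>{1..k}. \<exists>c. fst c \<in> {1, -1} \<and> snd c \<in> {1..k} \<and>
      (\<forall>r\<in>{1..2 ^ k}. D (\<pi> r) i = fst c * D r (snd c))"
  proof
    fix i assume "i \<in> {1..k}"
    then obtain a j where "a \<in> {1, -1}" "j \<in> {1..k}" "\<forall>r\<in>{1..2 ^ k}. D (\<pi> r) i = a * D r j"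
      using symmetry_column[OF \<pi> \<open>N > 0\<close>] by blast
    then show "\<exists>c. fst c \<in> {1, -1} \<and> snd c \<in> {1..k} \<and>
        (\<forall>r\<in>{1..2 ^ k}. D (\<pi> r) i = fst c * D r (snd c))"
      by (intro exI[of _ "(a, j)"]) (simp only: fst_conv snd_conv simp_thms)
  qed
  then obtain c where c: "\<forall>i\<in>{1..k}. fst (c i) \<in> {1, -1} \<and> snd (c i) \<in> {1..k} \<and>
      (\<forall>r\<in>{1..2 ^ k}. D (\<pi> r) i = fst (c i) * D r (snd (c i)))"
    by (rule bchoice[THEN exE])
  define a where "a i = fst (c i)" for i
  define \<tau> where "\<tau> i = snd (c i)" for i
  have a: "a i \<in> {1, -1}" and \<tau>: "\<tau> i \<in> {1..k}"
    and D\<pi>: "\<And>r. r \<in> {1..2 ^ k} \<Longrightarrow> D (\<pi> r) i = a i * D r (\<tau> i)" if "i \<in> {1..k}" for i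
    using bspec[OF c that] by (auto simp only: a_def \<tau>_def)
  have inj: "inj_on \<tau> {1..k}"
  proof (rule inj_onI, rule ccontr)
    fix i j assume ij: "i \<in> {1..k}" "j \<in> {1..k}" "\<tau> i = \<tau> j" "i \<noteq> j"
    have *: "sign_vec k S i * a j = sign_vec k S j * a i" for S
    proof -
      \<comment> \<open>Since \<open>\<pi>\<close> is onto, the permuted design still takes every
        value in the cube.\<close>
      define r where "r = inv' \<pi> (row (sign_vec k S))"
      have "r \<in> {1..2 ^ k}"
        using permutes_in_image[OF permutes_inv[OF p]] row_in[OF sign_vec_in_cube]
        unfolding r_def by blast
      moreover have "D (\<pi> r) = sign_vec k S"
        using permutes_inverses(1)[OF p] by (simp add: r_def)
      ultimately show ?thesis using D\<pi>[of i r] D\<pi>[of j r] ij by simp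
    qed
    \<comment> \<open>The all-ones vector forces \<open>a j = a i\<close>, and flipping only
      coordinate \<open>i\<close> forces \<open>- a j = a i\<close>.\<close>
    show False using *[of "{}"] *[of "{i}"] ij a[OF ij(1)] by (auto simp: sign_vec_apply)
  qed
  define \<sigma> where "\<sigma> i = (if i \<in> {1..k} then \<tau> i else i)" for i
  have \<sigma>: "\<sigma> permutes {1..k}"
  proof (rule bij_imp_permutes)
    have eq: "\<sigma> i = \<tau> i" if "i \<in> {1..k}" for i using that by (simp add: \<sigma>_def)
    have "inj_on \<sigma> {1..k}" using inj inj_on_cong[of "{1..k}" \<sigma> \<tau>, OF eq] by simp
    moreover have "\<sigma> ` {1..k} \<subseteq> {1..k}"
    proof (rule image_subsetI)
      show "\<sigma> i \<in> {1..k}" if "i \<in> {1..k}" for i unfolding eq[OF that] by (rule \<tau>[OF that])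
    qed
    ultimately show "bij_betw \<sigma> {1..k} {1..k}"
      unfolding bij_betw_def using endo_inj_surj[of "{1..k}" \<sigma>] by blast
  qed (simp only: \<sigma>_def if_False)
  define g where "g = (\<lambda>i\<in>{1..k}. if a i = 1 then id else transpose 1 (2::nat))"
  have sg: "sign (g i) = a i" if "i \<in> {1..k}" for i
    using a[OF that] that by (auto simp: g_def sign_swap_id)
  \<comment> \<open>The inverse appears because \<open>signed_action\<close> reads coordinates
    through the inverse of its permutation, while column \<open>i\<close> has to be read at
    \<open>\<sigma> i\<close>.\<close>
  define w where "w = (g, inv' \<sigma>)"
  have "{1..2::nat} = {1, 2}" by auto
  then have w: "w \<in> carrier (wreath_sym (sym_group 2) k)"
    using permutes_inv[OF \<sigma>] by (auto simp: w_def carrier_wreath_sym g_def permutes_doubleton_iff)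
  have "\<pi> r = row_perm w r" for r
  proof (cases "r \<in> {1..2 ^ k}")
    case True
    have \<pi>r: "\<pi> r \<in> {1..2 ^ k}" using permutes_in_image[OF p] True by blast
    have "D (\<pi> r) = signed_action k w (D r)"
    proof (rule PiE_ext[OF D_in_cube[OF \<pi>r] signed_action_in_cube[OF w D_in_cube[OF True]]])
      show "D (\<pi> r) i = signed_action k w (D r) i" if "i \<in> {1..k}" for i
        using D\<pi>[OF that True] sg[OF that] that inv_inv_eq[OF permutes_bij[OF \<sigma>]]
        by (simp add: signed_action_def w_def \<sigma>_def)
    qed
    then show ?thesis using row_D[OF \<pi>r] True by (simp add: row_perm_def)
  next
    case False
    then show ?thesis using permutes_not_in[OF p False] by (simp only: row_perm_def if_False)
  qed
  then show ?thesis using w by blast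
qed

section \<open>The isomorphism between the wreath product and the symmetry group\<close>

lemma row_perm_iso:
  assumes "N > 0"
  shows "row_perm \<in> iso (wreath_sym (sym_group 2) k) (oa_lp_symmetry_group N k 1 D)"
  unfolding iso_iff
proof (intro conjI)
  show "row_perm \<in> hom (wreath_sym (sym_group 2) k) (oa_lp_symmetry_group N k 1 D)"
  proof (rule homI)
    fix v w
    assume "v \<in> carrier (wreath_sym (sym_group 2) k)" "w \<in> carrier (wreath_sym (sym_group 2) k)"
    then show "row_perm (v \<otimes>\<^bsub>wreath_sym (sym_group 2) k\<^esub> w) =
        row_perm v \<otimes>\<^bsub>oa_lp_symmetry_group N k 1 D\<^esub> row_perm w"
      by (simp add: row_perm_mult oa_lp_symmetry_group_def sym_group_mult)
  qed (rule row_perm_in_symmetry_group)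
  show "row_perm ` carrier (wreath_sym (sym_group 2) k) = carrier (oa_lp_symmetry_group N k 1 D)"
    using row_perm_in_symmetry_group symmetry_in_range[OF _ assms] by blast
qed (rule row_perm_inj)

end

theorem theorem1:
  fixes k N :: nat and D :: "nat \<Rightarrow> nat \<Rightarrow> int"
  assumes "k \<ge> 1" and "N > 0" and "even N"
    and "full_factorial k D"
  shows "oa_lp_symmetry_group N k 1 D \<cong> wreath_sym (sym_group 2) k"
proof -
  interpret factorial_design k D by unfold_locales (rule assms(4))
  show ?thesis
    \<comment> \<open>\<open>row_perm\<close> starts from the wreath product, while the claim starts
      from the symmetry group; hence the inverse map.\<close>
    by (rule is_isoI[OF iso_inv_into[OF row_perm_iso[OF assms(2)] wreath_sym_closed]])
qed

end
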